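(* Let $w=(w(n))_{n\in\mathbb{N}}$ be a nonnegative weight sequence, let $\phi_{\gamma_{1,w}}$ be the fundamental sequence of the sequence Lorentz space $\gamma_{1,w}$, and let $\psi(n)=n/\phi_{\gamma_{1,w}}(n)$ for every $n\in\mathbb{N}$. Then $W(\infty)=\infty$ if and only if every bounded linear functional $f$ on $\gamma_{1,w}$ has the form $$f(x)=\sum_{n=1}^\infty x(n)y(n)\quad\text{for all }x\in\gamma_{1,w},\qquad\text{with}\quad \|f\|_{\gamma_{1,w}^*}=\|y\|_{m_\psi},$$ for some $y\in m_\psi$.
   Context: $\mathbb{N}$ is the set of positive integers and $\ell^0$ is the set of all real sequences. For $x\in\ell^0$ put $d_x(\lambda)=\operatorname{card}\{k\in\mathbb{N}:|x(k)|>\lambda\}$ for $\lambda\ge 0$, $x^*(n)=\inf\{\lambda\ge 0: d_x(\lambda)\le n-1\}$ (decreasing rearrangement) and $x^{**}(n)=\frac1n\sum_{i=1}^n x^*(i)$ for $n\in\mathbb{N}$. A nonnegative weight sequence is a sequence $w=(w(n))_{n\in\mathbb{N}}$ of nonnegative reals, with $w(n)>0$ for at least one $n$, such that $W_1(n)=n\sum_{i=n+1}^\infty \frac{w(i)}{i}<\infty$ for every $n\in\mathbb{N}$. Put $W(n)=\sum_{i=1}^n w(i)$ and $W(\infty)=\sum_{i=1}^\infty w(i)\in(0,\infty]$. The sequence Lorentz space $\gamma_{1,w}$ is the Banach space of all $x\in\ell^0$ with $\|x\|_{\gamma_{1,w}}=\sum_{n=1}^\infty x^{**}(n) w(n)<\infty$.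 Its fundamental sequence is $\phi_{\gamma_{1,w}}(n)=\|\chi_{\{i\in\mathbb{N}:i\le n\}}\|_{\gamma_{1,w}}=W(n)+W_1(n)$, $n\in\mathbb{N}$. $\gamma_{1,w}^*$ is its Banach dual. The Marcinkiewicz space $m_\psi$ is the Banach space of all $y\in\ell^0$ with $\|y\|_{m_\psi}=\sup_{n\in\mathbb{N}} y^{**}(n)\psi(n)<\infty$. *)

theory Defs
  imports "HOL-Analysis.Analysis"
begin

text \<open>
  The index set of a sequence is the set of positive integers. A real sequence is modelled as a
  function on \<^typ>\<open>nat\<close> that vanishes at the unused index 0, so that the indexing is the usual
  1-based one and every sequence has exactly one representative. Quantities that may be infinite
  are computed in \<^typ>\<open>enat\<close> or \<^typ>\<open>ennreal\<close>.
\<close>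

definition real_seqs :: "(nat \<Rightarrow> real) set" where
  "real_seqs = {x. x 0 = 0}"

definition char_seq :: "nat set \<Rightarrow> nat \<Rightarrow> real" where
  "char_seq A = indicator (A \<inter> {1..})"

text \<open>\<^const>\<open>card\<close> is 0 on infinite sets, hence the case distinction.\<close>

definition distr :: "(nat \<Rightarrow> real) \<Rightarrow> real \<Rightarrow> enat" where
  "distr x t = (let S = {k. 1 \<le> k \<and> \<bar>x k\<bar> > t} in if finite S then enat (card S) else \<infinity>)"

text \<open>The infimum is taken in \<^typ>\<open>ennreal\<close>; it is infinite when \<open>x\<close> is unbounded.\<close>

definition rearr :: "(nat \<Rightarrow> real) \<Rightarrow> nat \<Rightarrow> ennreal" where
  "rearr x n = (INF t \<in> {t. 0 \<le> t \<and> distr x t \<le> enat (n - 1)}. ennreal t)"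

definition max_rearr :: "(nat \<Rightarrow> real) \<Rightarrow> nat \<Rightarrow> ennreal" where
  "max_rearr x n = (\<Sum>i = 1..n. rearr x i) / of_nat n"

definition weight_tail :: "(nat \<Rightarrow> real) \<Rightarrow> nat \<Rightarrow> ennreal" where
  "weight_tail w n = of_nat n * (\<Sum>j. ennreal (w (n + 1 + j) / real (n + 1 + j)))"

definition weight_seq :: "(nat \<Rightarrow> real) \<Rightarrow> bool" where
  "weight_seq w \<longleftrightarrow>
     (\<forall>n\<ge>1. 0 \<le> w n) \<and> (\<exists>n\<ge>1. 0 < w n) \<and> (\<forall>n\<ge>1. weight_tail w n < \<infinity>)"

definition weight_total :: "(nat \<Rightarrow> real) \<Rightarrow> ennreal" where
  "weight_total w = (\<Sum>j. ennreal (w (j + 1)))"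

definition lorentz_enorm :: "(nat \<Rightarrow> real) \<Rightarrow> (nat \<Rightarrow> real) \<Rightarrow> ennreal" where
  "lorentz_enorm w x = (\<Sum>j. max_rearr x (j + 1) * ennreal (w (j + 1)))"

definition lorentz_space :: "(nat \<Rightarrow> real) \<Rightarrow> (nat \<Rightarrow> real) set" where
  "lorentz_space w = {x \<in> real_seqs. lorentz_enorm w x < \<infinity>}"

definition lorentz_norm :: "(nat \<Rightarrow> real) \<Rightarrow> (nat \<Rightarrow> real) \<Rightarrow> real" where
  "lorentz_norm w x = enn2real (lorentz_enorm w x)"

definition lorentz_fundamental :: "(nat \<Rightarrow> real) \<Rightarrow> nat \<Rightarrow> real" where
  "lorentz_fundamental w n = lorentz_norm w (char_seq {..n})"

definition marcinkiewicz_enorm :: "(nat \<Rightarrow> real) \<Rightarrow> (nat \<Rightarrow> real) \<Rightarrow> ennreal" where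
  "marcinkiewicz_enorm \<psi> y = (SUP n \<in> {1..}. max_rearr y n * ennreal (\<psi> n))"

definition marcinkiewicz_space :: "(nat \<Rightarrow> real) \<Rightarrow> (nat \<Rightarrow> real) set" where
  "marcinkiewicz_space \<psi> = {y \<in> real_seqs. marcinkiewicz_enorm \<psi> y < \<infinity>}"

definition marcinkiewicz_norm :: "(nat \<Rightarrow> real) \<Rightarrow> (nat \<Rightarrow> real) \<Rightarrow> real" where
  "marcinkiewicz_norm \<psi> y = enn2real (marcinkiewicz_enorm \<psi> y)"

text \<open>
  The Lorentz space depends on the parameter \<open>w\<close>, so it is a carrier set and not a type.
  A functional on it is a function of which only the values on the carrier matter.
\<close>

definition lorentz_functional :: "(nat \<Rightarrow> real) \<Rightarrow> ((nat \<Rightarrow> real) \<Rightarrow> real) \<Rightarrow> bool" where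
  "lorentz_functional w f \<longleftrightarrow>
     (\<forall>x \<in> lorentz_space w. \<forall>y \<in> lorentz_space w. f (\<lambda>k. x k + y k) = f x + f y) \<and>
     (\<forall>x \<in> lorentz_space w. \<forall>c. f (\<lambda>k. c * x k) = c * f x) \<and>
     (\<exists>C. \<forall>x \<in> lorentz_space w. \<bar>f x\<bar> \<le> C * lorentz_norm w x)"

definition lorentz_dual_norm :: "(nat \<Rightarrow> real) \<Rightarrow> ((nat \<Rightarrow> real) \<Rightarrow> real) \<Rightarrow> real" where
  "lorentz_dual_norm w f = (SUP x \<in> {x \<in> lorentz_space w. lorentz_norm w x \<le> 1}. \<bar>f x\<bar>)"

end

theory Submission
  imports Defs
begin

text \<open>
  Exchanging the order of summation turns the average \<open>x\<^sup>*\<^sup>*\<close> in the Lorentz norm into a weight: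
  \<open>\<parallel>x\<parallel> = \<Sum>i. x\<^sup>*(i) v(i)\<close> with the decreasing weight \<open>v(i) = \<Sum>n\<ge>i. w(n)/n\<close>
  (\<open>lorentz_enorm_by_levels\<close>). The partial sums \<open>V(n)\<close> of \<open>v\<close> are the fundamental sequence, so
  \<open>\<psi>(n) = n/V(n)\<close>, and the total mass of \<open>v\<close> is \<open>W(\<infinity>)\<close>. Since \<open>y\<^sup>*(1) + \<dots> + y\<^sup>*(n)\<close> is the
  supremum of the sums of \<open>\<bar>y\<bar>\<close> over \<open>n\<close>-element sets, the Marcinkiewicz norm of \<open>y\<close> is the least
  \<open>c\<close> such that \<open>\<Sum>k\<in>A. \<bar>y k\<bar> \<le> c V(card A)\<close> for all finite \<open>A\<close>.

  Let \<open>W(\<infinity>) = \<infinity>\<close>. An \<open>x\<close> in the Lorentz space then tends to 0, for otherwise \<open>x\<^sup>*\<close> would stay above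
  a positive constant and the norm would be infinite. By dominated convergence the tails of \<open>x\<close> tend
  to 0 in norm (\<open>lorentz_enorm_tail_tendsto_0\<close>), so a bounded functional \<open>f\<close> is determined by its
  values \<open>y(k) = f(e\<^sub>k)\<close> at the unit vectors, and \<open>f(x) = \<Sum>k. x(k) y(k)\<close>. Testing \<open>f\<close> against
  \<open>\<Sum>k\<in>A. sgn(y k) e\<^sub>k / V(card A)\<close>, which lies in the unit ball, shows that the Marcinkiewicz norm
  of \<open>y\<close> is at most that of \<open>f\<close> (\<open>sum_abs_coefficients_le\<close>). The reverse inequality comes from
  \<open>\<Sum>k\<in>A. \<bar>x k\<bar> \<bar>y k\<bar> \<le> c \<parallel>x\<parallel>\<close> (\<open>finite_pairing_le\<close>): when \<open>A\<close> is listed by decreasing \<open>\<bar>x\<bar>\<close>, Abel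
  summation reduces this to the inequalities that define \<open>c\<close>.

  Let \<open>W(\<infinity>) < \<infinity>\<close>. Then the Lorentz space consists of the bounded sequences, with a norm
  equivalent to the supremum norm. A generalized limit is therefore a bounded functional on it; it
  vanishes at every unit vector but has the value 1 at the constant sequence 1, so no \<open>y\<close> represents
  it (\<open>non_representable_functional\<close>).
\<close>

section \<open>Decreasing rearrangements and sums over finite sets\<close>

lemma rearr_le:
  assumes "0 \<le> t" "finite {k. 1 \<le> k \<and> t < \<bar>x k\<bar>}" "card {k. 1 \<le> k \<and> t < \<bar>x k\<bar>} \<le> n - 1"
  shows "rearr x n \<le> ennreal t"
  unfolding rearr_def using assms by (intro INF_lower) (auto simp: distr_def)

lemma rearr_greatest:
  assumes "\<And>t. 0 \<le> t \<Longrightarrow> finite {k. 1 \<le> k \<and> t < \<bar>x k\<bar>}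
             \<Longrightarrow> card {k. 1 \<le> k \<and> t < \<bar>x k\<bar>} \<le> n - 1 \<Longrightarrow> a \<le> ennreal t"
  shows "a \<le> rearr x n"
  unfolding rearr_def
proof (rule INF_greatest)
  fix t assume "t \<in> {t. 0 \<le> t \<and> distr x t \<le> enat (n - 1)}"
  then show "a \<le> ennreal t"
    by (intro assms) (auto simp: distr_def Let_def split: if_splits)
qed

lemma rearr_mono:
  assumes "\<And>k. 1 \<le> k \<Longrightarrow> \<bar>x k\<bar> \<le> \<bar>y k\<bar>"
  shows "rearr x n \<le> rearr y n"
proof (rule rearr_greatest)
  fix t assume t: "0 \<le> t" "finite {k. 1 \<le> k \<and> t < \<bar>y k\<bar>}" "card {k. 1 \<le> k \<and> t < \<bar>y k\<bar>} \<le> n - 1"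
  have sub: "{k. 1 \<le> k \<and> t < \<bar>x k\<bar>} \<subseteq> {k. 1 \<le> k \<and> t < \<bar>y k\<bar>}"
    using assms by force
  show "rearr x n \<le> ennreal t"
    using rearr_le[of t x n] t finite_subset[OF sub] card_mono[OF _ sub] by linarith
qed

lemma rearr_le_bound:
  assumes "0 \<le> c" "\<And>k. 1 \<le> k \<Longrightarrow> \<bar>x k\<bar> \<le> c"
  shows "rearr x n \<le> ennreal c"
proof -
  have "{k. 1 \<le> k \<and> c < \<bar>x k\<bar>} = {}"
    using assms(2) by force
  then show ?thesis
    using rearr_le[of c x n] assms(1) by (metis card.empty finite.emptyI le0)
qed

lemma rearr_eq_0_beyond_support:
  assumes "finite A" "card A < n" "\<And>k. 1 \<le> k \<Longrightarrow> k \<notin> A \<Longrightarrow> x k = 0"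
  shows "rearr x n = 0"
proof -
  have sub: "{k. 1 \<le> k \<and> 0 < \<bar>x k\<bar>} \<subseteq> A"
    using assms(3) by force
  have "rearr x n \<le> ennreal 0"
    using assms by (intro rearr_le) (use finite_subset[OF sub] card_mono[OF _ sub] in \<open>auto dest: order.strict_trans1\<close>)
  then show ?thesis by simp
qed

lemma le_rearr:
  assumes "finite A" "A \<subseteq> {1..}" "1 \<le> n" "n \<le> card A" "\<And>k. k \<in> A \<Longrightarrow> a \<le> \<bar>x k\<bar>"
  shows "ennreal a \<le> rearr x n"
proof (rule rearr_greatest)
  fix t assume t: "0 \<le> t" "finite {k. 1 \<le> k \<and> t < \<bar>x k\<bar>}" "card {k. 1 \<le> k \<and> t < \<bar>x k\<bar>} \<le> n - 1"
  have "\<not> A \<subseteq> {k. 1 \<le> k \<and> t < \<bar>x k\<bar>}"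
    using card_mono[OF t(2), of A] t(3) assms(3,4) by linarith
  then obtain k where "k \<in> A" "\<bar>x k\<bar> \<le> t"
    using assms(2) by force
  then show "ennreal a \<le> ennreal t"
    using assms(5)[of k] by (intro ennreal_leI) linarith
qed

lemma le_rearr_if_infinite:
  assumes "infinite {k. 1 \<le> k \<and> a \<le> \<bar>x k\<bar>}" "1 \<le> n"
  shows "ennreal a \<le> rearr x n"
proof -
  obtain A where "finite A" "card A = n" "A \<subseteq> {k. 1 \<le> k \<and> a \<le> \<bar>x k\<bar>}"
    using infinite_arbitrarily_large[OF assms(1)] by blast
  then show ?thesis
    using assms(2) by (intro le_rearr[of A]) auto
qed

text \<open>At least \<open>n\<close> terms exceed a level below \<open>rearr x n\<close>, so \<open>A\<close> cannot contain all of them. This is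
  the greedy step in choosing distinct indices that nearly attain the first values of the
  rearrangement.\<close>

lemma exceeds_level_below_rearr:
  assumes "ennreal t < rearr x n" "0 \<le> t" "finite A" "card A < n"
  shows "\<exists>k\<ge>1. k \<notin> A \<and> t < \<bar>x k\<bar>"
proof (rule ccontr)
  assume "\<not> ?thesis"
  then have sub: "{k. 1 \<le> k \<and> t < \<bar>x k\<bar>} \<subseteq> A" by force
  have "rearr x n \<le> ennreal t"
    using assms by (intro rearr_le) (use finite_subset[OF sub] card_mono[OF _ sub] in \<open>auto dest: order.strict_trans1\<close>)
  with assms(1) show False by simp
qed

lemma decreasing_enumeration:
  fixes g :: "nat \<Rightarrow> real"
  assumes "finite A"
  obtains xs where "distinct xs" "set xs = A" "length xs = card A"
    "\<And>i j. i \<le> j \<Longrightarrow> j < length xs \<Longrightarrow> g (xs ! j) \<le> g (xs ! i)"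
proof -
  define xs where "xs = sort_key (\<lambda>k. - g k) (sorted_list_of_set A)"
  have xs: "distinct xs" "set xs = A" "length xs = card A"
    using assms by (simp_all add: xs_def)
  have "g (xs ! j) \<le> g (xs ! i)" if "i \<le> j" "j < length xs" for i j
  proof -
    have "sorted (map (\<lambda>k. - g k) xs)" by (simp add: xs_def)
    from sorted_nth_mono[OF this that(1)] that show ?thesis by simp
  qed
  with xs show ?thesis using that by blast
qed

lemma sum_over_enumeration:
  fixes h :: "nat \<Rightarrow> 'b :: comm_monoid_add"
  assumes "distinct xs"
  shows "sum h (set xs) = (\<Sum>i<length xs. h (xs ! i))"
  using assms by (simp add: sum.distinct_set_conv_list interv_sum_list_conv_sum_set_nat
      sum_list_sum_nth atLeast0LessThan)

text \<open>The first \<open>i + 1\<close> entries of a list sorted by decreasing \<open>\<bar>x\<bar>\<close> are indices at which \<open>\<bar>x\<bar>\<close> is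
  at least as large as at the last of them.\<close>

lemma nth_le_rearr:
  assumes "distinct xs" "set xs \<subseteq> {1..}" "i < length xs"
    "\<And>i j. i \<le> j \<Longrightarrow> j < length xs \<Longrightarrow> \<bar>x (xs ! j)\<bar> \<le> \<bar>x (xs ! i)\<bar>"
  shows "ennreal \<bar>x (xs ! i)\<bar> \<le> rearr x (Suc i)"
proof (rule le_rearr)
  show "finite (set (take (Suc i) xs))" "1 \<le> Suc i" by simp_all
  show "set (take (Suc i) xs) \<subseteq> {1..}"
    using assms(2) set_take_subset by fastforce
  show "Suc i \<le> card (set (take (Suc i) xs))"
    using assms(1,3) by (simp add: distinct_card)
  fix k assume "k \<in> set (take (Suc i) xs)"
  then obtain j where "j \<le> i" "k = xs ! j"
    by (auto simp: in_set_conv_nth less_Suc_eq_le)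
  then show "\<bar>x (xs ! i)\<bar> \<le> \<bar>x k\<bar>" using assms(3,4) by simp
qed

lemma sum_abs_le_sum_rearr:
  assumes "finite A" "A \<subseteq> {1..}"
  shows "ennreal (\<Sum>k\<in>A. \<bar>y k\<bar>) \<le> (\<Sum>i<card A. rearr y (Suc i))"
proof -
  obtain xs where xs: "distinct xs" "set xs = A" "length xs = card A"
    "\<And>i j. i \<le> j \<Longrightarrow> j < length xs \<Longrightarrow> \<bar>y (xs ! j)\<bar> \<le> \<bar>y (xs ! i)\<bar>"
    by (rule decreasing_enumeration[OF assms(1), of "\<lambda>k. \<bar>y k\<bar>"]) blast
  have "ennreal (\<Sum>k\<in>A. \<bar>y k\<bar>) = (\<Sum>k\<in>set xs. ennreal \<bar>y k\<bar>)"
    by (simp add: xs(2))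
  also have "\<dots> = (\<Sum>i<card A. ennreal \<bar>y (xs ! i)\<bar>)"
    by (subst sum_over_enumeration[OF xs(1)]) (simp add: xs(3))
  also have "\<dots> \<le> (\<Sum>i<card A. rearr y (Suc i))"
    using xs assms(2) by (intro sum_mono nth_le_rearr) auto
  finally show ?thesis .
qed

text \<open>Together with \<open>sum_abs_le_sum_rearr\<close> this identifies the sum of the first \<open>n\<close> values of the
  rearrangement as a supremum over \<open>n\<close>-element sets. The supremum need not be attained (the values
  may increase to a limit), so the indices are chosen greedily with an error of at most \<open>d\<close> each.
  Boundedness makes the rearrangement finite and the errors real numbers.\<close>

lemma sum_rearr_le:
  assumes bdd: "\<And>k. 1 \<le> k \<Longrightarrow> \<bar>y k\<bar> \<le> D" "0 \<le> D" and "0 \<le> C"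
    and sums: "\<And>A. finite A \<Longrightarrow> A \<subseteq> {1..} \<Longrightarrow> card A = n \<Longrightarrow> (\<Sum>k\<in>A. \<bar>y k\<bar>) \<le> C"
  shows "(\<Sum>i<n. rearr y (Suc i)) \<le> ennreal C"
proof -
  define r where "r i = enn2real (rearr y (Suc i))" for i
  have r: "rearr y (Suc i) = ennreal (r i)" for i
  proof -
    have "rearr y (Suc i) \<le> ennreal D"
      by (rule rearr_le_bound[OF bdd(2)]) (rule bdd(1))
    from le_less_trans[OF this ennreal_less_top] show ?thesis by (simp add: r_def)
  qed
  have r0: "0 \<le> r i" for i by (simp add: r_def)
  have "(\<Sum>i<n. r i) \<le> C + e" if e: "0 < e" for e
  proof -
    define d where "d = e / (n + 1)"
    have d: "0 < d" "n * d \<le> e" using e by (auto simp: d_def field_simps)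
    have "\<exists>A. finite A \<and> A \<subseteq> {1..} \<and> card A = m \<and> (\<Sum>i<m. r i) \<le> (\<Sum>k\<in>A. \<bar>y k\<bar>) + m * d" for m
    proof (induction m)
      case 0
      show ?case by (intro exI[of _ "{}"]) simp
    next
      case (Suc m)
      then obtain A where A: "finite A" "A \<subseteq> {1..}" "card A = m"
        "(\<Sum>i<m. r i) \<le> (\<Sum>k\<in>A. \<bar>y k\<bar>) + m * d" by blast
      have "\<exists>k\<ge>1. k \<notin> A \<and> r m \<le> \<bar>y k\<bar> + d"
      proof (cases "d \<le> r m")
        case True
        have "ennreal (r m - d) < rearr y (Suc m)"
          unfolding r using True d by (simp add: ennreal_less_iff)
        from exceeds_level_below_rearr[OF this _ A(1)] True A(3) show ?thesis by force
      next
        (* The required lower bound is negative here, so any unused index will do. *)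
        case False
        have "infinite ({1..} - A)"
          using A(1) infinite_Ici by (rule Diff_infinite_finite)
        then have "{1..} - A \<noteq> {}" by (metis finite.emptyI)
        then obtain k where "k \<in> {1..}" "k \<notin> A" by blast
        then show ?thesis using False by (intro exI[of _ k]) auto
      qed
      then obtain k where k: "1 \<le> k" "k \<notin> A" "r m \<le> \<bar>y k\<bar> + d" by blast
      then show ?case
        using A by (intro exI[of _ "insert k A"]) (auto simp: algebra_simps)
    qed
    then obtain A where A: "finite A" "A \<subseteq> {1..}" "card A = n"
        "(\<Sum>i<n. r i) \<le> (\<Sum>k\<in>A. \<bar>y k\<bar>) + n * d" by blast
    then show ?thesis using sums[OF A(1-3)] d by linarith
  qed
  then have "(\<Sum>i<n. r i) \<le> C" by (rule field_le_epsilon)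
  then show ?thesis by (simp add: r sum_ennreal r0 ennreal_leI)
qed

text \<open>Abel summation: the difference of the two sides is a combination of the nonnegative partial
  sums \<open>S\<close> of \<open>u - b\<close>, with the nonnegative decrements of \<open>d\<close> as coefficients. The induction keeps
  only the boundary term \<open>d m * S (Suc m)\<close> of that combination.\<close>

lemma abel_majorization:
  fixes b u d :: "nat \<Rightarrow> real"
  assumes "\<And>i. i < N \<Longrightarrow> 0 \<le> d i" "\<And>i j. i \<le> j \<Longrightarrow> j < N \<Longrightarrow> d j \<le> d i"
    and "\<And>j. j \<le> N \<Longrightarrow> (\<Sum>i<j. b i) \<le> (\<Sum>i<j. u i)"
  shows "(\<Sum>i<N. d i * b i) \<le> (\<Sum>i<N. d i * u i)"
proof (cases N)
  case (Suc M)
  define S where "S j = (\<Sum>i<j. u i - b i)" for j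
  have S0: "0 \<le> S j" if "j \<le> N" for j
    using assms(3)[OF that] by (simp add: S_def sum_subtractf)
  have "d m * S (Suc m) \<le> (\<Sum>i<Suc m. d i * (u i - b i))" if "m < N" for m
    using that
  proof (induction m)
    case 0
    then show ?case by (simp add: S_def)
  next
    case (Suc m)
    have "d (Suc m) * S (Suc m) \<le> d m * S (Suc m)"
      using Suc.prems assms(2)[of m "Suc m"] S0[of "Suc m"] by (intro mult_right_mono) auto
    also have "\<dots> \<le> (\<Sum>i<Suc m. d i * (u i - b i))"
      using Suc by simp
    finally show ?case by (simp add: S_def algebra_simps)
  qed
  from this[of M] have "d M * S N \<le> (\<Sum>i<N. d i * (u i - b i))" using Suc by simp
  moreover have "0 \<le> d M * S N" using assms(1)[of M] S0[of N] Suc by simp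
  ultimately show ?thesis by (simp add: algebra_simps sum_subtractf)
qed simp

section \<open>The Lorentz norm with a decreasing weight\<close>

text \<open>The weight that multiplies the rearrangement in the Lorentz norm. It is indexed from 0:
  \<open>level_weight w i\<close> belongs to the \<open>(i + 1)\<close>-st value of the rearrangement.\<close>

definition level_weight :: "(nat \<Rightarrow> real) \<Rightarrow> nat \<Rightarrow> ennreal" where
  "level_weight w i = (\<Sum>j. ennreal (w (Suc (i + j)) / real (Suc (i + j))))"

definition level_sum :: "(nat \<Rightarrow> real) \<Rightarrow> nat \<Rightarrow> real" where
  "level_sum w n = (\<Sum>i<n. enn2real (level_weight w i))"

text \<open>Tonelli's theorem for the counting measure.\<close>

lemma suminf_ennreal_swap:
  fixes g :: "nat \<Rightarrow> nat \<Rightarrow> ennreal"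
  shows "(\<Sum>j. \<Sum>i. g i j) = (\<Sum>i. \<Sum>j. g i j)"
  using nn_integral_suminf[of g "count_space UNIV"]
  by (simp add: nn_integral_count_space_nat)

text \<open>Both sides are the sum of \<open>a (i + 1) w (j + 1) / (j + 1)\<close> over all \<open>i \<le> j\<close>; the function \<open>g\<close>
  extends the summand by 0 to all pairs. For the rearrangement in place of \<open>a\<close> this rewrites the
  Lorentz norm, and for \<open>a = 1\<close> it computes the total weight.\<close>

lemma averages_by_levels:
  assumes "\<And>n. 1 \<le> n \<Longrightarrow> 0 \<le> w n"
  shows "(\<Sum>j. (\<Sum>i=1..j + 1. a i) / of_nat (j + 1) * ennreal (w (j + 1)))
       = (\<Sum>i. a (Suc i) * level_weight w i)"
proof -
  define h where "h j = ennreal (w (Suc j) / real (Suc j))" for j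
  define g where "g i j = (if i \<le> j then a (Suc i) * h j else 0)" for i j
  have "(\<Sum>i=1..j + 1. a i) / of_nat (j + 1) * ennreal (w (j + 1)) = (\<Sum>i. g i j)" for j
  proof -
    have "h j = ennreal (w (j + 1)) / of_nat (j + 1)"
      using assms[of "Suc j"] unfolding h_def
      by (simp add: divide_ennreal[symmetric] ennreal_of_nat_eq_real_of_nat del: of_nat_Suc)
    then have "(\<Sum>i=1..j + 1. a i) / of_nat (j + 1) * ennreal (w (j + 1)) = (\<Sum>i=1..j + 1. a i) * h j"
      by (simp add: divide_ennreal_def mult_ac)
    also have "\<dots> = (\<Sum>i\<le>j. a (Suc i)) * h j"
      by (simp only: add_Suc_right add_0_right One_nat_def sum.atLeast1_atMost_eq lessThan_Suc_atMost)
    also have "\<dots> = (\<Sum>i\<le>j. g i j)"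
      by (simp add: g_def sum_distrib_right)
    also have "\<dots> = (\<Sum>i. g i j)"
      by (intro suminf_finite[symmetric]) (auto simp: g_def)
    finally show ?thesis .
  qed
  moreover have "(\<Sum>j. g i j) = a (Suc i) * level_weight w i" for i
  proof -
    have "(\<Sum>j. g i j) = (\<Sum>j. g i (j + i)) + (\<Sum>j<i. g i j)"
      by (rule suminf_offset) simp
    also have "(\<Sum>j<i. g i j) = 0" by (simp add: g_def)
    also have "(\<Sum>j. g i (j + i)) = a (Suc i) * level_weight w i"
      by (simp add: g_def level_weight_def h_def add.commute del: of_nat_Suc)
    finally show ?thesis by simp
  qed
  ultimately show ?thesis
    using suminf_ennreal_swap[of g] by simp
qed

context
  fixes w :: "nat \<Rightarrow> real"
  assumes w: "weight_seq w"
begin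

lemma weight_nonneg: "1 \<le> n \<Longrightarrow> 0 \<le> w n"
  using w by (simp add: weight_seq_def)

lemma lorentz_enorm_by_levels: "lorentz_enorm w x = (\<Sum>i. rearr x (Suc i) * level_weight w i)"
  unfolding lorentz_enorm_def max_rearr_def
  by (rule averages_by_levels) (rule weight_nonneg)

lemma weight_total_by_levels: "weight_total w = (\<Sum>i. level_weight w i)"
proof -
  have avg: "(\<Sum>i=1..j + 1. 1::ennreal) / of_nat (j + 1) = 1" for j
    using ennreal_divide_self[of "of_nat (Suc j)"]
    by (simp add: less_top[symmetric] of_nat_less_top del: of_nat_Suc)
  have "(\<Sum>j. (\<Sum>i=1..j + 1. 1) / of_nat (j + 1) * ennreal (w (j + 1))) = (\<Sum>i. 1 * level_weight w i)"
    by (rule averages_by_levels) (rule weight_nonneg)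
  then show ?thesis unfolding avg weight_total_def by simp
qed

lemma level_weight_Suc: "level_weight w i = ennreal (w (Suc i) / real (Suc i)) + level_weight w (Suc i)"
  unfolding level_weight_def
  by (subst suminf_offset[where i = "Suc 0"]) (simp_all add: add.commute)

lemma level_weight_antimono: "i \<le> j \<Longrightarrow> level_weight w j \<le> level_weight w i"
  by (rule lift_Suc_antimono_le[of "level_weight w"]) (subst (2) level_weight_Suc, simp_all)

lemma level_weight_finite: "level_weight w i < \<infinity>"
proof -
  have "level_weight w (Suc 0) \<le> weight_tail w 1"
    by (simp add: weight_tail_def level_weight_def)
  also have "\<dots> < \<infinity>"
    using w unfolding weight_seq_def by blast
  finally have "level_weight w 0 < \<infinity>"
    by (subst level_weight_Suc) simp
  then show ?thesis
    using level_weight_antimono[of 0 i] by (meson le0 le_less_trans)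
qed

lemma level_weight_0_pos: "0 < level_weight w 0"
proof -
  obtain n where n: "1 \<le> n" "0 < w n"
    using w by (auto simp: weight_seq_def)
  have "level_weight w (n - 1) > 0"
    using n by (subst level_weight_Suc) (simp add: add_pos_nonneg)
  then show ?thesis
    using level_weight_antimono[of 0 "n - 1"] by (meson le0 less_le_trans)
qed

lemma ennreal_level_weight: "ennreal (enn2real (level_weight w i)) = level_weight w i"
  using level_weight_finite[of i] by (simp add: less_top)

lemma ennreal_level_sum: "ennreal (level_sum w n) = (\<Sum>i<n. level_weight w i)"
  unfolding level_sum_def by (subst sum_ennreal[symmetric]) (simp_all add: ennreal_level_weight)

lemma level_sum_pos: "1 \<le> n \<Longrightarrow> 0 < level_sum w n"
  unfolding level_sum_def
  using level_weight_0_pos level_weight_finite[of 0]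
  by (intro sum_pos2[where i = 0]) (auto simp: enn2real_positive_iff)

lemma lorentz_enorm_mono:
  assumes "\<And>k. 1 \<le> k \<Longrightarrow> \<bar>x k\<bar> \<le> \<bar>y k\<bar>"
  shows "lorentz_enorm w x \<le> lorentz_enorm w y"
  unfolding lorentz_enorm_by_levels
  using assms by (intro suminf_le mult_right_mono rearr_mono) auto

text \<open>The rearrangement of such an \<open>x\<close> is at most \<open>c\<close>, and it vanishes beyond \<open>card A\<close>.\<close>

lemma lorentz_enorm_le_support:
  assumes A: "finite A" and c: "0 \<le> c" "\<And>k. 1 \<le> k \<Longrightarrow> \<bar>x k\<bar> \<le> c * indicator A k"
  shows "lorentz_enorm w x \<le> ennreal (c * level_sum w (card A))"
proof -
  have 0: "rearr x (Suc i) = 0" if "card A \<le> i" for i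
    using that A c(2) by (intro rearr_eq_0_beyond_support[of A]) (force simp: indicator_def)+
  have "lorentz_enorm w x = (\<Sum>i<card A. rearr x (Suc i) * level_weight w i)"
    unfolding lorentz_enorm_by_levels by (intro suminf_finite) (auto simp: 0)
  also have "\<dots> \<le> (\<Sum>i<card A. ennreal c * level_weight w i)"
  proof (intro sum_mono mult_right_mono rearr_le_bound c(1))
    fix k :: nat assume "1 \<le> k"
    then show "\<bar>x k\<bar> \<le> c" using c(1) c(2)[of k] by (cases "k \<in> A") auto
  qed simp
  also have "\<dots> = ennreal (c * level_sum w (card A))"
    by (simp add: sum_distrib_left[symmetric] ennreal_level_sum ennreal_mult' c(1))
  finally show ?thesis .
qed

lemma lorentz_space_if_finite_support:
  assumes "finite A" "x 0 = 0" "\<And>k. k \<notin> A \<Longrightarrow> x k = 0"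
  shows "x \<in> lorentz_space w"
proof -
  have "\<bar>x k\<bar> \<le> (\<Sum>k\<in>A. \<bar>x k\<bar>) * indicator A k" for k
    using assms member_le_sum[of k A "\<lambda>k. \<bar>x k\<bar>"] by (auto simp: indicator_def)
  then have "lorentz_enorm w x \<le> ennreal ((\<Sum>k\<in>A. \<bar>x k\<bar>) * level_sum w (card A))"
    by (intro lorentz_enorm_le_support assms sum_nonneg) auto
  then show ?thesis
    using assms(2) by (auto simp: lorentz_space_def real_seqs_def less_top[symmetric] top_unique)
qed

lemma ennreal_lorentz_norm: "x \<in> lorentz_space w \<Longrightarrow> ennreal (lorentz_norm w x) = lorentz_enorm w x"
  by (simp add: lorentz_norm_def lorentz_space_def less_top)

text \<open>The Lorentz space embeds into the bounded sequences.\<close>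

lemma abs_le_lorentz_norm:
  assumes "x \<in> lorentz_space w"
  shows "\<bar>x k\<bar> * enn2real (level_weight w 0) \<le> lorentz_norm w x"
proof (cases "k = 0")
  case True
  then show ?thesis using assms by (simp add: lorentz_space_def real_seqs_def lorentz_norm_def)
next
  case False
  have "ennreal \<bar>x k\<bar> \<le> rearr x (Suc 0)"
    using False by (intro le_rearr[of "{k}"]) auto
  then have "ennreal \<bar>x k\<bar> * level_weight w 0 \<le> rearr x (Suc 0) * level_weight w 0"
    by (rule mult_right_mono) simp
  also have "\<dots> \<le> lorentz_enorm w x"
    unfolding lorentz_enorm_by_levels
    using sum_le_suminf[of "\<lambda>i. rearr x (Suc i) * level_weight w i" "{0}"] by simp
  also have "\<dots> = ennreal (lorentz_norm w x)"
    by (rule ennreal_lorentz_norm[OF assms, symmetric])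
  also have "ennreal \<bar>x k\<bar> * level_weight w 0 = ennreal (\<bar>x k\<bar> * enn2real (level_weight w 0))"
    by (simp add: ennreal_mult ennreal_level_weight)
  finally show ?thesis by (simp add: lorentz_norm_def)
qed

text \<open>The rearrangement of the indicator of \<open>n\<close> indices is 1 up to \<open>n\<close> and 0 from there on.\<close>

lemma lorentz_fundamental_eq: "lorentz_fundamental w n = level_sum w n"
proof -
  let ?x = "char_seq {..n}"
  have "lorentz_enorm w ?x \<le> ennreal (1 * level_sum w (card {1..n}))"
    by (rule lorentz_enorm_le_support) (auto simp: char_seq_def indicator_def)
  moreover have "ennreal (level_sum w n) \<le> lorentz_enorm w ?x"
  proof -
    have "1 \<le> rearr ?x (Suc i)" if "i < n" for i
      using that le_rearr[of "{1..n}" "Suc i" 1 ?x] by (auto simp: char_seq_def)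
    then have "(\<Sum>i<n. 1 * level_weight w i) \<le> (\<Sum>i<n. rearr ?x (Suc i) * level_weight w i)"
      by (intro sum_mono mult_right_mono) auto
    also have "\<dots> \<le> lorentz_enorm w ?x"
      unfolding lorentz_enorm_by_levels by (rule sum_le_suminf) auto
    finally show ?thesis by (simp add: ennreal_level_sum)
  qed
  ultimately have "lorentz_enorm w ?x = ennreal (level_sum w n)" by simp
  then show ?thesis
    by (simp add: lorentz_fundamental_def lorentz_norm_def level_sum_def sum_nonneg)
qed

text \<open>This is the duality inequality. Along an enumeration of \<open>A\<close> by decreasing \<open>\<bar>x\<bar>\<close>, the hypothesis
  compares each partial sum of \<open>\<bar>y\<bar>\<close> with the partial sum of \<open>c\<close> times the weight, so
  \<open>abel_majorization\<close> allows the weight to replace \<open>\<bar>y\<bar>\<close>. Then \<open>\<bar>x\<bar>\<close> is dominated by its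
  rearrangement.\<close>

lemma finite_pairing_le:
  assumes A: "finite A" "A \<subseteq> {1..}" and x: "x \<in> lorentz_space w"
    and y: "\<And>B. B \<subseteq> A \<Longrightarrow> (\<Sum>k\<in>B. \<bar>y k\<bar>) \<le> c * level_sum w (card B)" and c: "0 \<le> c"
  shows "(\<Sum>k\<in>A. \<bar>x k\<bar> * \<bar>y k\<bar>) \<le> c * lorentz_norm w x"
proof -
  obtain xs where xs: "distinct xs" "set xs = A" "length xs = card A"
    "\<And>i j. i \<le> j \<Longrightarrow> j < length xs \<Longrightarrow> \<bar>x (xs ! j)\<bar> \<le> \<bar>x (xs ! i)\<bar>"
    by (rule decreasing_enumeration[OF A(1), of "\<lambda>k. \<bar>x k\<bar>"]) blast
  let ?v = "\<lambda>i. enn2real (level_weight w i)"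
  have "(\<Sum>k\<in>A. \<bar>x k\<bar> * \<bar>y k\<bar>) = (\<Sum>i<length xs. \<bar>x (xs ! i)\<bar> * \<bar>y (xs ! i)\<bar>)"
    using sum_over_enumeration[OF xs(1)] by (simp add: xs(2))
  also have "\<dots> \<le> (\<Sum>i<length xs. \<bar>x (xs ! i)\<bar> * (c * ?v i))"
  proof (rule abel_majorization)
    fix j assume j: "j \<le> length xs"
    have "(\<Sum>i<j. \<bar>y (xs ! i)\<bar>) = (\<Sum>k\<in>set (take j xs). \<bar>y k\<bar>)"
      using j by (subst sum_over_enumeration) (simp_all add: xs(1))
    also have "\<dots> \<le> c * level_sum w (card (set (take j xs)))"
      by (rule y) (metis set_take_subset xs(2))
    also have "card (set (take j xs)) = j"
      using j by (simp add: distinct_card xs(1))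
    finally show "(\<Sum>i<j. \<bar>y (xs ! i)\<bar>) \<le> (\<Sum>i<j. c * ?v i)"
      by (simp add: level_sum_def sum_distrib_left)
  qed (use xs(4) in auto)
  also have "\<dots> = c * (\<Sum>i<length xs. \<bar>x (xs ! i)\<bar> * ?v i)"
    by (simp add: sum_distrib_left mult_ac)
  also have "\<dots> \<le> c * lorentz_norm w x"
  proof (rule mult_left_mono[OF _ c])
    have "ennreal (\<Sum>i<length xs. \<bar>x (xs ! i)\<bar> * ?v i)
        = (\<Sum>i<length xs. ennreal \<bar>x (xs ! i)\<bar> * level_weight w i)"
      by (subst sum_ennreal[symmetric]) (simp_all add: ennreal_mult ennreal_level_weight)
    also have "\<dots> \<le> (\<Sum>i<length xs. rearr x (Suc i) * level_weight w i)"
      using xs A(2) by (intro sum_mono mult_right_mono nth_le_rearr) auto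
    also have "\<dots> \<le> lorentz_enorm w x"
      unfolding lorentz_enorm_by_levels by (rule sum_le_suminf) auto
    also have "\<dots> = ennreal (lorentz_norm w x)"
      by (rule ennreal_lorentz_norm[OF x, symmetric])
    finally show "(\<Sum>i<length xs. \<bar>x (xs ! i)\<bar> * ?v i) \<le> lorentz_norm w x"
      by (simp add: lorentz_norm_def)
  qed
  finally show ?thesis .
qed

text \<open>If \<open>\<bar>x\<bar> \<ge> e\<close> at infinitely many indices, then the whole rearrangement is at least \<open>e\<close>, and the
  norm is at least \<open>e\<close> times the total weight. This is where the hypothesis of infinite total weight
  enters.\<close>

lemma finite_superlevel:
  assumes tot: "weight_total w = \<infinity>" and x: "x \<in> lorentz_space w" and e: "0 < e"
  shows "finite {k. 1 \<le> k \<and> e \<le> \<bar>x k\<bar>}"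
proof (rule ccontr)
  assume inf: "infinite {k. 1 \<le> k \<and> e \<le> \<bar>x k\<bar>}"
  have "ennreal e * weight_total w \<le> lorentz_enorm w x"
    unfolding weight_total_by_levels lorentz_enorm_by_levels ennreal_suminf_cmult[symmetric]
    by (intro suminf_le mult_right_mono le_rearr_if_infinite[OF inf]) auto
  then show False
    using tot x e by (simp add: lorentz_space_def ennreal_mult_top top_unique)
qed

text \<open>Each value of the rearrangement of the tail tends to 0, because \<open>x\<close> does; the terms of the norm
  of \<open>x\<close> dominate, so the norms of the tails tend to 0 too.\<close>

lemma lorentz_enorm_tail_tendsto_0:
  assumes tot: "weight_total w = \<infinity>" and x: "x \<in> lorentz_space w"
  shows "(\<lambda>N. lorentz_enorm w (\<lambda>k. if k \<le> N then 0 else x k)) \<longlonglongrightarrow> 0"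
proof -
  define z where "z N k = (if k \<le> N then 0 else x k)" for N k :: nat
  have le: "rearr (z N) n \<le> rearr x n" for N n
    by (rule rearr_mono) (simp add: z_def)
  have lim: "(\<lambda>N. rearr (z N) n) \<longlonglongrightarrow> 0" for n
  proof (rule order_tendstoI)
    fix a :: ennreal assume "0 < a"
    then obtain b where b: "0 < b" "b < a" using dense by blast
    then obtain e where e: "b = ennreal e" "0 < e"
      by (cases b) auto
    obtain M where M: "\<And>k. 1 \<le> k \<Longrightarrow> e \<le> \<bar>x k\<bar> \<Longrightarrow> k \<le> M"
      using finite_superlevel[OF tot x e(2)] by (auto simp: finite_nat_set_iff_bounded_le)
    show "\<forall>\<^sub>F N in sequentially. rearr (z N) n < a"
      using eventually_ge_at_top[of M]
    proof eventually_elim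
      case (elim N)
      have "rearr (z N) n \<le> ennreal e"
        using e M elim by (intro rearr_le_bound) (force simp: z_def)+
      then show ?case using b e by simp
    qed
  qed simp
  have "(\<lambda>N. \<integral>\<^sup>+i. rearr (z N) (Suc i) * level_weight w i \<partial>count_space UNIV)
      \<longlonglongrightarrow> (\<integral>\<^sup>+i. 0 \<partial>count_space (UNIV::nat set))"
  proof (rule nn_integral_dominated_convergence[where w = "\<lambda>i. rearr x (Suc i) * level_weight w i"])
    show "(\<integral>\<^sup>+i. rearr x (Suc i) * level_weight w i \<partial>count_space UNIV) < \<infinity>"
      using x by (simp add: nn_integral_count_space_nat lorentz_enorm_by_levels[symmetric] lorentz_space_def)
    show "AE i in count_space UNIV. (\<lambda>N. rearr (z N) (Suc i) * level_weight w i) \<longlonglongrightarrow> 0"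
    proof (rule AE_I2)
      fix i
      show "(\<lambda>N. rearr (z N) (Suc i) * level_weight w i) \<longlonglongrightarrow> 0"
        using ennreal_tendsto_cmult[OF level_weight_finite[of i, unfolded infinity_ennreal_def] lim[of "Suc i"]]
        by (simp add: mult.commute)
    qed
    show "AE i in count_space UNIV. rearr (z N) (Suc i) * level_weight w i \<le> rearr x (Suc i) * level_weight w i" for N
      by (intro AE_I2 mult_right_mono le) simp
  qed auto
  then show ?thesis
    by (simp add: nn_integral_count_space_nat lorentz_enorm_by_levels z_def[abs_def])
qed

section \<open>The Marcinkiewicz norm through sums over finite sets\<close>

lemma max_rearr_fundamental:
  assumes "\<psi> n = real n / lorentz_fundamental w n" "1 \<le> n"
  shows "max_rearr y n * ennreal (\<psi> n) = (\<Sum>i<n. rearr y (Suc i)) / ennreal (level_sum w n)"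
proof -
  have "ennreal (\<psi> n) = of_nat n / ennreal (level_sum w n)"
    using assms level_sum_pos[OF assms(2)]
    by (simp add: lorentz_fundamental_eq divide_ennreal[symmetric] ennreal_of_nat_eq_real_of_nat)
  moreover have "(\<Sum>i=1..n. rearr y i) = (\<Sum>i<n. rearr y (Suc i))"
    by (simp only: One_nat_def sum.atLeast1_atMost_eq)
  moreover have "inverse (of_nat n) * of_nat n = (1::ennreal)"
    using ennreal_divide_self[of "of_nat n"] assms(2)
    by (simp add: divide_ennreal_def less_top[symmetric] of_nat_less_top mult.commute)
  ultimately show ?thesis
    unfolding max_rearr_def divide_ennreal_def
    by (metis (no_types, lifting) mult.assoc mult_1)
qed

lemma marcinkiewicz_enorm_le:
  assumes psi: "\<And>n. 1 \<le> n \<Longrightarrow> \<psi> n = real n / lorentz_fundamental w n"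
    and c: "0 \<le> c" "\<And>A. finite A \<Longrightarrow> A \<subseteq> {1..} \<Longrightarrow> (\<Sum>k\<in>A. \<bar>y k\<bar>) \<le> c * level_sum w (card A)"
  shows "marcinkiewicz_enorm \<psi> y \<le> ennreal c"
  unfolding marcinkiewicz_enorm_def
proof (rule SUP_least)
  fix n :: nat assume "n \<in> {1..}"
  then have n: "1 \<le> n" by simp
  have "(\<Sum>i<n. rearr y (Suc i)) \<le> ennreal (c * level_sum w n)"
  proof (rule sum_rearr_le)
    show "\<bar>y k\<bar> \<le> c * level_sum w 1" if "1 \<le> k" for k
      using that c(2)[of "{k}"] by simp
    show "0 \<le> c * level_sum w 1" "0 \<le> c * level_sum w n"
      using c(1) by (simp_all add: level_sum_def sum_nonneg)
    show "(\<Sum>k\<in>A. \<bar>y k\<bar>) \<le> c * level_sum w n" if "finite A" "A \<subseteq> {1..}" "card A = n" for A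
      using c(2)[of A] that by simp
  qed
  then show "max_rearr y n * ennreal (\<psi> n) \<le> ennreal c"
    unfolding max_rearr_fundamental[where \<psi> = \<psi>, OF psi[OF n] n] using level_sum_pos[OF n] c(1)
    by (intro divide_le_posI_ennreal) (simp_all add: ennreal_mult mult.commute)
qed

lemma sum_abs_le_marcinkiewicz_norm:
  assumes psi: "\<And>n. 1 \<le> n \<Longrightarrow> \<psi> n = real n / lorentz_fundamental w n"
    and y: "y \<in> marcinkiewicz_space \<psi>" and A: "finite A" "A \<subseteq> {1..}"
  shows "(\<Sum>k\<in>A. \<bar>y k\<bar>) \<le> marcinkiewicz_norm \<psi> y * level_sum w (card A)"
proof (cases "A = {}")
  case False
  define n where "n = card A"
  define S where "S = (\<Sum>i<n. rearr y (Suc i))"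
  have n: "1 \<le> n" using False A(1) by (simp add: n_def Suc_le_eq card_gt_0_iff)
  note V = level_sum_pos[OF n]
  have "S / ennreal (level_sum w n) = max_rearr y n * ennreal (\<psi> n)"
    by (simp add: max_rearr_fundamental[where \<psi> = \<psi>, OF psi[OF n] n] S_def)
  also have "\<dots> \<le> marcinkiewicz_enorm \<psi> y"
    unfolding marcinkiewicz_enorm_def using n by (intro SUP_upper) simp
  also have "\<dots> = ennreal (marcinkiewicz_norm \<psi> y)"
    using y by (simp add: marcinkiewicz_norm_def marcinkiewicz_space_def less_top)
  finally have *: "S / ennreal (level_sum w n) \<le> ennreal (marcinkiewicz_norm \<psi> y)" .
  have "ennreal (\<Sum>k\<in>A. \<bar>y k\<bar>) \<le> S"
    using sum_abs_le_sum_rearr[OF A] by (simp add: S_def n_def)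
  also have "S = S / ennreal (level_sum w n) * ennreal (level_sum w n)"
  proof -
    have "inverse (ennreal (level_sum w n)) * ennreal (level_sum w n) = 1"
      using V by (simp add: inverse_ennreal ennreal_mult[symmetric] del: ennreal_1)
    then show ?thesis by (simp add: divide_ennreal_def mult.assoc)
  qed
  also have "\<dots> \<le> ennreal (marcinkiewicz_norm \<psi> y) * ennreal (level_sum w n)"
    using * by (rule mult_right_mono) simp
  also have "\<dots> = ennreal (marcinkiewicz_norm \<psi> y * level_sum w n)"
    using V by (simp add: ennreal_mult marcinkiewicz_norm_def)
  finally show ?thesis
    using V by (simp add: n_def marcinkiewicz_norm_def)
qed (simp add: level_sum_def)

section \<open>Bounded functionals and their coefficients\<close>

lemma lorentz_functional_finite_support:
  assumes f: "lorentz_functional w f" and A: "finite A" "A \<subseteq> {1..}"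
  shows "f (\<lambda>k. if k \<in> A then x k else 0) = (\<Sum>k\<in>A. x k * f (char_seq {k}))"
  using A
proof (induction A rule: finite_induct)
  case empty
  have "(\<lambda>k. 0) \<in> lorentz_space w"
    by (rule lorentz_space_if_finite_support[of "{}"]) auto
  moreover have "\<forall>x\<in>lorentz_space w. \<forall>c. f (\<lambda>k. c * x k) = c * f x"
    using f by (simp add: lorentz_functional_def)
  ultimately have "\<forall>c. f (\<lambda>k. c * 0) = c * f (\<lambda>_. 0)"
    by (rule bspec[rotated])
  from spec[OF this, of 0] have "f (\<lambda>_. 0) = 0" by simp
  then show ?case by simp
next
  case (insert a A)
  have a: "char_seq {a} \<in> lorentz_space w"
    by (rule lorentz_space_if_finite_support[of "{a}"]) (auto simp: char_seq_def)
  have xa: "(\<lambda>k. x a * char_seq {a} k) \<in> lorentz_space w"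
    by (rule lorentz_space_if_finite_support[of "{a}"]) (auto simp: char_seq_def)
  have xA: "(\<lambda>k. if k \<in> A then x k else 0) \<in> lorentz_space w"
    using insert by (intro lorentz_space_if_finite_support[of A]) auto
  have "(\<lambda>k. if k \<in> insert a A then x k else 0)
      = (\<lambda>k. (if k \<in> A then x k else 0) + x a * char_seq {a} k)"
    using insert.hyps insert.prems by (auto simp: char_seq_def fun_eq_iff indicator_def)
  then have "f (\<lambda>k. if k \<in> insert a A then x k else 0)
      = f (\<lambda>k. if k \<in> A then x k else 0) + f (\<lambda>k. x a * char_seq {a} k)"
    using f xa xA unfolding lorentz_functional_def by simp
  also have "f (\<lambda>k. x a * char_seq {a} k) = x a * f (char_seq {a})"
    using f a unfolding lorentz_functional_def by simp
  finally show ?case using insert by simp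
qed

lemma abs_le_lorentz_dual_norm:
  assumes f: "lorentz_functional w f" and x: "x \<in> lorentz_space w" "lorentz_norm w x \<le> 1"
  shows "\<bar>f x\<bar> \<le> lorentz_dual_norm w f"
  unfolding lorentz_dual_norm_def
proof (rule cSUP_upper)
  obtain C where C: "\<And>x. x \<in> lorentz_space w \<Longrightarrow> \<bar>f x\<bar> \<le> C * lorentz_norm w x"
    using f unfolding lorentz_functional_def by blast
  show "bdd_above ((\<lambda>x. \<bar>f x\<bar>) ` {x \<in> lorentz_space w. lorentz_norm w x \<le> 1})"
  proof (rule bdd_aboveI2)
    fix x assume "x \<in> {x \<in> lorentz_space w. lorentz_norm w x \<le> 1}"
    then have x: "x \<in> lorentz_space w" "lorentz_norm w x \<le> 1" by auto
    have "\<bar>f x\<bar> \<le> C * lorentz_norm w x" by (rule C[OF x(1)])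
    also have "\<dots> \<le> \<bar>C\<bar> * 1"
      using x(2) by (intro mult_mono) (auto simp: lorentz_norm_def)
    finally show "\<bar>f x\<bar> \<le> \<bar>C\<bar>" by simp
  qed
qed (use x in simp)

lemma zero_in_lorentz_ball: "(\<lambda>_. 0) \<in> {x \<in> lorentz_space w. lorentz_norm w x \<le> 1}"
proof -
  have "lorentz_enorm w (\<lambda>_. 0) \<le> ennreal (0 * level_sum w (card ({}::nat set)))"
    by (rule lorentz_enorm_le_support) auto
  then show ?thesis by (simp add: lorentz_norm_def lorentz_space_def real_seqs_def)
qed

text \<open>The test sequence \<open>x\<close> carries the signs of the coefficients on \<open>A\<close>; dividing it by the norm of
  the indicator of \<open>A\<close> puts it into the unit ball.\<close>

lemma sum_abs_coefficients_le:
  assumes f: "lorentz_functional w f" and A: "finite A" "A \<subseteq> {1..}"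
  shows "(\<Sum>k\<in>A. \<bar>f (char_seq {k})\<bar>) \<le> lorentz_dual_norm w f * level_sum w (card A)"
proof (cases "A = {}")
  case False
  define V where "V = level_sum w (card A)"
  have V: "0 < V"
    unfolding V_def using False A(1) by (intro level_sum_pos) (simp add: Suc_le_eq card_gt_0_iff)
  define x where "x k = (if k \<in> A then sgn (f (char_seq {k})) / V else 0)" for k
  have x: "x \<in> lorentz_space w"
    using A by (intro lorentz_space_if_finite_support[of A]) (auto simp: x_def)
  have "lorentz_enorm w x \<le> ennreal (1 / V * level_sum w (card A))"
    using V A by (intro lorentz_enorm_le_support) (auto simp: x_def abs_sgn_eq)
  then have "lorentz_enorm w x \<le> ennreal 1"
    using V by (simp add: V_def)
  then have "lorentz_norm w x \<le> 1"
    unfolding lorentz_norm_def by (intro enn2real_leI) auto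
  from abs_le_lorentz_dual_norm[OF f x this] have "f x \<le> lorentz_dual_norm w f" by simp
  moreover have "f x = (\<Sum>k\<in>A. sgn (f (char_seq {k})) / V * f (char_seq {k}))"
    unfolding x_def by (rule lorentz_functional_finite_support[OF f A])
  moreover have "\<dots> = (\<Sum>k\<in>A. \<bar>f (char_seq {k})\<bar>) / V"
    by (simp add: sum_divide_distrib abs_sgn mult.commute)
  ultimately show ?thesis using V by (simp add: V_def field_simps)
qed (simp add: level_sum_def)

text \<open>The partial sums are the values of \<open>f\<close> at the truncations of \<open>x\<close>, and the tails \<open>z N\<close> tend to 0
  in norm.\<close>

lemma lorentz_functional_sums:
  assumes tot: "weight_total w = \<infinity>" and f: "lorentz_functional w f" and x: "x \<in> lorentz_space w"
  shows "(\<lambda>j. x (j + 1) * f (char_seq {j + 1})) sums f x"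
proof -
  obtain C where C: "\<And>x. x \<in> lorentz_space w \<Longrightarrow> \<bar>f x\<bar> \<le> C * lorentz_norm w x"
    using f unfolding lorentz_functional_def by blast
  have x0: "x 0 = 0" using x by (simp add: lorentz_space_def real_seqs_def)
  define z where "z N = (\<lambda>k. if k \<le> N then 0 else x k)" for N :: nat
  have z: "z N \<in> lorentz_space w" for N
    using le_less_trans[OF lorentz_enorm_mono[of "z N" x]] x
    by (auto simp: z_def lorentz_space_def real_seqs_def)
  have partial: "(\<Sum>j<N. x (j + 1) * f (char_seq {j + 1})) = f x - f (z N)" for N
  proof -
    define t where "t k = (if k \<in> {1..N} then x k else 0)" for k
    have t: "t \<in> lorentz_space w"
      by (rule lorentz_space_if_finite_support[of "{1..N}"]) (auto simp: t_def)
    have "x = (\<lambda>k. t k + z N k)"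
      by (auto simp: t_def z_def fun_eq_iff x0 Suc_le_eq)
    then have "f x = f t + f (z N)"
      using f t z unfolding lorentz_functional_def by metis
    moreover have "f t = (\<Sum>k\<in>{1..N}. x k * f (char_seq {k}))"
      unfolding t_def by (rule lorentz_functional_finite_support[OF f]) auto
    moreover have "\<dots> = (\<Sum>j<N. x (j + 1) * f (char_seq {j + 1}))"
      by (simp add: sum.atLeast1_atMost_eq)
    ultimately show ?thesis by simp
  qed
  have "(\<lambda>N. lorentz_norm w (z N)) \<longlonglongrightarrow> enn2real 0"
    unfolding lorentz_norm_def z_def
    by (rule tendsto_enn2real) (use lorentz_enorm_tail_tendsto_0[OF tot x] in simp_all)
  then have "(\<lambda>N. C * lorentz_norm w (z N)) \<longlonglongrightarrow> 0"
    using tendsto_mult_right_zero by fastforce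
  then have "(\<lambda>N. f (z N)) \<longlonglongrightarrow> 0"
    by (rule Lim_null_comparison[rotated]) (simp add: C[OF z])
  then have "(\<lambda>N. f x - f (z N)) \<longlonglongrightarrow> f x - 0"
    by (intro tendsto_diff tendsto_const)
  then show ?thesis unfolding sums_def partial by simp
qed

lemma lorentz_dual_representation:
  assumes tot: "weight_total w = \<infinity>" and f: "lorentz_functional w f"
    and psi: "\<And>n. 1 \<le> n \<Longrightarrow> \<psi> n = real n / lorentz_fundamental w n"
  shows "\<exists>y \<in> marcinkiewicz_space \<psi>.
    (\<forall>x \<in> lorentz_space w. (\<lambda>j. x (j + 1) * y (j + 1)) sums f x) \<and>
    lorentz_dual_norm w f = marcinkiewicz_norm \<psi> y"
proof -
  define y where "y k = (if k = 0 then 0 else f (char_seq {k}))" for k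
  define D where "D = lorentz_dual_norm w f"
  have sums: "(\<lambda>j. x (j + 1) * y (j + 1)) sums f x" if "x \<in> lorentz_space w" for x
    using lorentz_functional_sums[OF tot f that] by (simp add: y_def)
  have D: "0 \<le> D"
    using abs_le_lorentz_dual_norm[OF f, of "\<lambda>_. 0"] zero_in_lorentz_ball by (auto simp: D_def)
  have "marcinkiewicz_enorm \<psi> y \<le> ennreal D"
  proof (rule marcinkiewicz_enorm_le[OF psi D])
    fix A :: "nat set" assume A: "finite A" "A \<subseteq> {1..}"
    then have "(\<Sum>k\<in>A. \<bar>y k\<bar>) = (\<Sum>k\<in>A. \<bar>f (char_seq {k})\<bar>)"
      by (intro sum.cong) (auto simp: y_def)
    then show "(\<Sum>k\<in>A. \<bar>y k\<bar>) \<le> D * level_sum w (card A)"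
      using sum_abs_coefficients_le[OF f A] by (simp add: D_def)
  qed
  then have y: "y \<in> marcinkiewicz_space \<psi>" and le: "marcinkiewicz_norm \<psi> y \<le> D"
    using D by (auto simp: marcinkiewicz_space_def real_seqs_def y_def marcinkiewicz_norm_def
        less_top[symmetric] top_unique intro: enn2real_leI)
  define M where "M = marcinkiewicz_norm \<psi> y"
  have "D \<le> M"
    unfolding D_def lorentz_dual_norm_def
  proof (rule cSUP_least)
    show "{x \<in> lorentz_space w. lorentz_norm w x \<le> 1} \<noteq> {}"
      using zero_in_lorentz_ball by blast
    fix x assume "x \<in> {x \<in> lorentz_space w. lorentz_norm w x \<le> 1}"
    then have x: "x \<in> lorentz_space w" "lorentz_norm w x \<le> 1" by auto
    have M: "0 \<le> M" by (simp add: M_def marcinkiewicz_norm_def)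
    have "\<bar>\<Sum>j<N. x (j + 1) * y (j + 1)\<bar> \<le> M" for N
    proof -
      have "\<bar>\<Sum>j<N. x (j + 1) * y (j + 1)\<bar> \<le> (\<Sum>j<N. \<bar>x (j + 1)\<bar> * \<bar>y (j + 1)\<bar>)"
        by (rule order.trans[OF sum_abs]) (simp add: abs_mult)
      also have "\<dots> = (\<Sum>k\<in>{1..N}. \<bar>x k\<bar> * \<bar>y k\<bar>)"
        by (simp add: sum.atLeast1_atMost_eq)
      also have "\<dots> \<le> M * lorentz_norm w x"
      proof (rule finite_pairing_le[OF _ _ x(1) _ M])
        fix B assume "B \<subseteq> {1..N}"
        then show "(\<Sum>k\<in>B. \<bar>y k\<bar>) \<le> M * level_sum w (card B)"
          unfolding M_def
          by (intro sum_abs_le_marcinkiewicz_norm psi y) (auto intro: finite_subset)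
      qed auto
      also have "\<dots> \<le> M" using x(2) M by (rule mult_left_le)
      finally show ?thesis .
    qed
    moreover have "(\<lambda>N. \<bar>\<Sum>j<N. x (j + 1) * y (j + 1)\<bar>) \<longlonglongrightarrow> \<bar>f x\<bar>"
      using sums[OF x(1)] unfolding sums_def by (rule tendsto_rabs)
    ultimately show "\<bar>f x\<bar> \<le> M" by (intro LIMSEQ_le_const2) auto
  qed
  with le have "lorentz_dual_norm w f = marcinkiewicz_norm \<psi> y" by (simp add: D_def M_def)
  with sums y show ?thesis by blast
qed

lemma one_in_lorentz_space:
  assumes "weight_total w \<noteq> \<infinity>"
  shows "char_seq UNIV \<in> lorentz_space w"
proof -
  have "rearr (char_seq UNIV) (Suc i) \<le> ennreal 1" for i
    by (rule rearr_le_bound) (auto simp: char_seq_def indicator_def)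
  then have "lorentz_enorm w (char_seq UNIV) \<le> (\<Sum>i. ennreal 1 * level_weight w i)"
    unfolding lorentz_enorm_by_levels by (intro suminf_le mult_right_mono) auto
  also have "\<dots> < \<infinity>"
    using assms by (simp add: weight_total_by_levels less_top)
  finally show ?thesis by (simp add: lorentz_space_def real_seqs_def char_seq_def)
qed

end

section \<open>A generalized limit on bounded sequences\<close>

text \<open>The evaluations \<open>e k\<close> at the indices \<open>k\<close> lie in a product of compact intervals, which is compact
  by Tychonoff's theorem, so the sequence of evaluations has a cluster point \<open>L\<close>. Each required
  property is an equation or inequality between finitely many coordinates that holds for all \<open>e k\<close>,
  or a limit along \<open>k\<close>, and it passes to \<open>L\<close> along the filter \<open>G\<close>. Unbounded sequences get the
  value 0, so that every coordinate of the evaluations is bounded.\<close>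

lemma generalized_limit_exists:
  obtains L :: "(nat \<Rightarrow> real) \<Rightarrow> real" where
    "\<And>x y. bounded (range x) \<Longrightarrow> bounded (range y) \<Longrightarrow> L (\<lambda>k. x k + y k) = L x + L y"
    "\<And>x c. bounded (range x) \<Longrightarrow> L (\<lambda>k. c * x k) = c * L x"
    "\<And>x B. (\<And>k. \<bar>x k\<bar> \<le> B) \<Longrightarrow> \<bar>L x\<bar> \<le> B"
    "\<And>x l. x \<longlonglongrightarrow> l \<Longrightarrow> L x = l"
proof -
  define e :: "nat \<Rightarrow> (nat \<Rightarrow> real) \<Rightarrow> real"
    where "e k x = (if bounded (range x) then x k else 0)" for k x
  have "\<exists>B. \<forall>k. \<bar>e k x\<bar> \<le> B" for x
  proof (cases "bounded (range x)")
    case True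
    then show ?thesis by (simp add: e_def bounded_iff)
  next
    case False
    then show ?thesis by (intro exI[of _ 0]) (simp add: e_def)
  qed
  then obtain B where B: "\<And>x k. \<bar>e k x\<bar> \<le> B x" by metis
  have "compact (PiE UNIV (\<lambda>x. cball (0::real) (B x)))"
    using compactin_PiE[of "\<lambda>_. euclidean" UNIV "\<lambda>x. cball (0::real) (B x)"]
    by (simp add: euclidean_product_topology)
  moreover have "eventually (\<lambda>g. g \<in> PiE UNIV (\<lambda>x. cball (0::real) (B x))) (filtermap e sequentially)"
    by (simp add: eventually_filtermap B PiE_UNIV_domain)
  moreover have "filtermap e sequentially \<noteq> bot"
    by (simp add: filtermap_bot_iff)
  ultimately obtain L where L: "inf (nhds L) (filtermap e sequentially) \<noteq> bot"
    unfolding compact_filter by blast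
  define G where "G = inf (nhds L) (filtermap e sequentially)"
  have nontriv: "G \<noteq> bot" using L by (simp add: G_def)
  have lim: "((\<lambda>g. g x) \<longlongrightarrow> L x) G" for x
  proof -
    have "((\<lambda>g. g x) \<longlongrightarrow> L x) (nhds L)"
    proof (rule topological_tendstoI)
      fix S :: "real set" assume S: "open S" "L x \<in> S"
      have "open ((\<lambda>g :: (nat \<Rightarrow> real) \<Rightarrow> real. g x) -` S)"
        by (intro open_vimage S(1) continuous_on_product_coordinates)
      with S(2) show "eventually (\<lambda>g. g x \<in> S) (nhds L)"
        unfolding eventually_nhds by (intro exI[of _ "(\<lambda>g. g x) -` S"]) simp
    qed
    then show ?thesis unfolding G_def by (rule tendsto_mono[rotated]) simp
  qed
  have ev: "eventually P G" if "\<And>k. P (e k)" for P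
    unfolding G_def using that
    by (intro filter_leD[OF inf_le2]) (simp add: eventually_filtermap)
  show ?thesis
  proof (rule that[of L])
    fix x y :: "nat \<Rightarrow> real" assume xy: "bounded (range x)" "bounded (range y)"
    then have "bounded (range (\<lambda>k. x k + y k))" by (rule bounded_plus_comp)
    with xy have "eventually (\<lambda>g. g x + g y = g (\<lambda>k. x k + y k)) G"
      by (intro ev) (simp add: e_def)
    then have "((\<lambda>g. g (\<lambda>k. x k + y k)) \<longlongrightarrow> L x + L y) G"
      using tendsto_add[OF lim[of x] lim[of y]] by (rule Lim_transform_eventually[rotated])
    then show "L (\<lambda>k. x k + y k) = L x + L y" by (rule tendsto_unique[OF nontriv lim])
  next
    fix x :: "nat \<Rightarrow> real" and c assume x: "bounded (range x)"
    then have "bounded (range (\<lambda>k. c * x k))"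
      using bounded_scaling[of "range x" c] by (simp add: image_image)
    with x have "eventually (\<lambda>g. c * g x = g (\<lambda>k. c * x k)) G"
      by (intro ev) (simp add: e_def)
    then have "((\<lambda>g. g (\<lambda>k. c * x k)) \<longlongrightarrow> c * L x) G"
      using tendsto_mult_left[OF lim[of x]] by (rule Lim_transform_eventually[rotated])
    then show "L (\<lambda>k. c * x k) = c * L x" by (rule tendsto_unique[OF nontriv lim])
  next
    fix x :: "nat \<Rightarrow> real" and B assume "\<And>k. \<bar>x k\<bar> \<le> B"
    then have "eventually (\<lambda>g. \<bar>g x\<bar> \<le> B) G"
      by (intro ev) (auto simp: e_def intro: order.trans[OF abs_ge_zero])
    then show "\<bar>L x\<bar> \<le> B"
      using tendsto_rabs[OF lim[of x]] by (intro tendsto_upperbound[OF _ _ nontriv])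
  next
    fix x :: "nat \<Rightarrow> real" and l assume x: "x \<longlonglongrightarrow> l"
    then have "bounded (range x)" by (intro convergent_imp_bounded)
    with x have "((\<lambda>g. g x) \<longlongrightarrow> l) (filtermap e sequentially)"
      by (simp add: filterlim_filtermap e_def)
    then have "((\<lambda>g. g x) \<longlongrightarrow> l) G"
      unfolding G_def by (rule tendsto_mono[rotated]) simp
    then show "L x = l" by (rule tendsto_unique[OF nontriv lim])
  qed
qed

section \<open>Duality and the total weight\<close>

text \<open>A representing \<open>y\<close> would vanish, since the generalized limit is 0 at every unit vector; but the
  constant sequence 1 belongs to the space when the total weight is finite.\<close>

lemma non_representable_functional:
  assumes w: "weight_seq w" and tot: "weight_total w \<noteq> \<infinity>"
  obtains f where "lorentz_functional w f"
    "\<nexists>y. \<forall>x \<in> lorentz_space w. (\<lambda>j. x (j + 1) * y (j + 1)) sums f x"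
proof -
  obtain L :: "(nat \<Rightarrow> real) \<Rightarrow> real" where L:
    "\<And>x y. bounded (range x) \<Longrightarrow> bounded (range y) \<Longrightarrow> L (\<lambda>k. x k + y k) = L x + L y"
    "\<And>x c. bounded (range x) \<Longrightarrow> L (\<lambda>k. c * x k) = c * L x"
    "\<And>x B. (\<And>k. \<bar>x k\<bar> \<le> B) \<Longrightarrow> \<bar>L x\<bar> \<le> B"
    "\<And>x l. x \<longlonglongrightarrow> l \<Longrightarrow> L x = l"
    by (rule generalized_limit_exists) blast
  define v where "v = enn2real (level_weight w 0)"
  have v: "0 < v"
    using level_weight_0_pos[OF w] level_weight_finite[OF w, of 0]
    by (simp add: v_def enn2real_positive_iff)
  have le: "\<bar>x k\<bar> \<le> 1 / v * lorentz_norm w x" if "x \<in> lorentz_space w" for x k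
    using abs_le_lorentz_norm[OF w that, of k] v by (simp add: v_def field_simps)
  have bdd: "bounded (range x)" if "x \<in> lorentz_space w" for x
    using le[OF that] by (auto simp: bounded_iff)
  have "lorentz_functional w L"
    unfolding lorentz_functional_def
  proof (intro conjI ballI allI exI[of _ "1 / v"])
    fix x y assume "x \<in> lorentz_space w" "y \<in> lorentz_space w"
    then show "L (\<lambda>k. x k + y k) = L x + L y" by (intro L(1) bdd)
  next
    fix x c assume "x \<in> lorentz_space w"
    then show "L (\<lambda>k. c * x k) = c * L x" by (intro L(2) bdd)
  next
    fix x assume "x \<in> lorentz_space w"
    then show "\<bar>L x\<bar> \<le> 1 / v * lorentz_norm w x" by (intro L(3) le)
  qed
  moreover have False
    if y: "\<forall>x \<in> lorentz_space w. (\<lambda>j. x (j + 1) * y (j + 1)) sums L x" for y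
  proof -
    have "y (n + 1) = 0" for n
    proof -
      let ?e = "char_seq {n + 1}"
      have "?e \<in> lorentz_space w"
        by (rule lorentz_space_if_finite_support[OF w, of "{n + 1}"]) (auto simp: char_seq_def)
      with y have "(\<lambda>j. ?e (j + 1) * y (j + 1)) sums L ?e" by blast
      moreover have "(\<lambda>j. ?e (j + 1) * y (j + 1)) = (\<lambda>j. if j = n then y (j + 1) else 0)"
        by (auto simp: char_seq_def)
      ultimately have "L ?e = y (n + 1)"
        using sums_single[of n "\<lambda>j. y (j + 1)"] by (simp add: sums_unique2)
      moreover have "?e \<longlonglongrightarrow> 0"
      proof (rule tendsto_eventually)
        show "\<forall>\<^sub>F k in sequentially. ?e k = 0"
          using eventually_gt_at_top[of "n + 1"] by eventually_elim (simp add: char_seq_def)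
      qed
      ultimately show ?thesis using L(4) by metis
    qed
    moreover have "(\<lambda>j. char_seq UNIV (j + 1) * y (j + 1)) sums L (char_seq UNIV)"
      using y one_in_lorentz_space[OF w tot] by blast
    ultimately have "L (char_seq UNIV) = 0"
      by (simp add: sums_0 sums_iff)
    moreover have "char_seq UNIV \<longlonglongrightarrow> 1"
    proof (rule tendsto_eventually)
      show "\<forall>\<^sub>F k in sequentially. char_seq UNIV k = 1"
        using eventually_gt_at_top[of 0] by eventually_elim (simp add: char_seq_def)
    qed
    ultimately show False using L(4) by fastforce
  qed
  ultimately show ?thesis using that by blast
qed

theorem theorem5p1:
  fixes w \<psi> :: "nat \<Rightarrow> real"
  assumes "weight_seq w"
    and "\<And>n. 1 \<le> n \<Longrightarrow> \<psi> n = real n / lorentz_fundamental w n"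
  shows "weight_total w = \<infinity> \<longleftrightarrow>
    (\<forall>f. lorentz_functional w f \<longrightarrow>
      (\<exists>y \<in> marcinkiewicz_space \<psi>.
        (\<forall>x \<in> lorentz_space w. (\<lambda>j. x (j + 1) * y (j + 1)) sums f x) \<and>
        lorentz_dual_norm w f = marcinkiewicz_norm \<psi> y))"
proof
  assume "weight_total w = \<infinity>"
  then show "\<forall>f. lorentz_functional w f \<longrightarrow>
      (\<exists>y \<in> marcinkiewicz_space \<psi>.
        (\<forall>x \<in> lorentz_space w. (\<lambda>j. x (j + 1) * y (j + 1)) sums f x) \<and>
        lorentz_dual_norm w f = marcinkiewicz_norm \<psi> y)"
    by (intro allI impI lorentz_dual_representation[OF assms(1) _ _ assms(2)])
next
  assume rep: "\<forall>f. lorentz_functional w f \<longrightarrow>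
      (\<exists>y \<in> marcinkiewicz_space \<psi>.
        (\<forall>x \<in> lorentz_space w. (\<lambda>j. x (j + 1) * y (j + 1)) sums f x) \<and>
        lorentz_dual_norm w f = marcinkiewicz_norm \<psi> y)"
  show "weight_total w = \<infinity>"
  proof (rule ccontr)
    assume "weight_total w \<noteq> \<infinity>"
    then obtain f where f: "lorentz_functional w f"
      "\<nexists>y. \<forall>x \<in> lorentz_space w. (\<lambda>j. x (j + 1) * y (j + 1)) sums f x"
      by (rule non_representable_functional[OF assms(1)])
    from rep f(1) obtain y where "\<forall>x \<in> lorentz_space w. (\<lambda>j. x (j + 1) * y (j + 1)) sums f x"
      by meson
    with f(2) show False by blast
  qed
qed

end
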